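(* Consider a left-invariant Lorentzian problem on $G=\mathrm{Aff}_+(\mathbb R)$ given by a matrix $A=\begin{pmatrix}a&b\\c&d\end{pmatrix}$, $|A|>0$, $a\ge0$, with sectional curvature $K<0$. Let $q_0=\mathrm{Id}$ and $q_1\in J^+=J^+(\mathrm{Id})$. (1) If $q_1\in D$, then there exists a Lorentzian length maximizer from $q_0$ to $q_1$. (2) If $q_1\in E$, then there exist arbitrarily long (in the sense of Lorentzian length) future directed nonspacelike trajectories from $q_0$ to $q_1$. Thus $d(q_0,q_1)=+\infty$ and there are no Lorentzian length maximizers from $q_0$ to $q_1$.
   Context: $G=\mathrm{Aff}_+(\mathbb R)=\{(x,y)\in\mathbb R^2: y>0\}$ with product $(x_2,y_2)\cdot(x_1,y_1)=(x_2+y_2x_1,\,y_2y_1)$ and identity $\mathrm{Id}=(0,1)$; left-invariant frame $X_1=y\,\partial_x$, $X_2=y\,\partial_y$. A real matrix $A=\begin{pmatrix}a&b\\c&d\end{pmatrix}$ with $|A|=ad-bc>0$ determines the left-invariant Lorentzian form $g(u_1X_1+u_2X_2)=-v_1^2+v_2^2$, $v_1=au_1+bu_2$, $v_2=cu_1+du_2$, with time orientation in which future directed nonspacelike vectors are those with $v_1\ge|v_2|$. Standing assumption of the paper: $a\ge0$. The sectional curvature is the constant $K=(c^2-a^2)/|A|^2$. A future directed nonspacelike curve is a Lipschitz curve $q:[0,t_1]\to G$ whose velocity is a.e. future directed nonspacelike; its Lorentzian length is $l(q)=\int_0^{t_1}\sqrt{v_1^2-v_2^2}\,dt$. $J^+(q_0)$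 is the set of endpoints of such curves starting at $q_0$. For $q_1\in J^+(q_0)$, $d(q_0,q_1)$ is the supremum of $l$ over such curves from $q_0$ to $q_1$; a Lorentzian length maximizer is such a curve attaining a (finite) supremum. $\lambda_1(x,y)=(c-a)x+(d-b)(y-1)$, $\lambda_2(x,y)=(c+a)x+(d+b)(y-1)$. For $K<0$ put $B=\left(\frac{d+b}{c+a},0\right)$, $\lambda_3(q)=\lambda_1(q)-\lambda_1(B)$, and $D=\{q\in G:\lambda_1(q)\le0\le\lambda_2(q),\ \lambda_3(q)>0\}$, $F=\{q\in G:\lambda_3(q)=0\}$, $E=\{q\in G:\lambda_3(q)<0\}$; then $J^+(\mathrm{Id})=D\sqcup F\sqcup E$. *)

theory Defs
  imports "HOL-Analysis.Analysis"
begin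

text \<open>The group of orientation preserving affine maps of the line; \<open>(x, y)\<close> is the map
  \<open>s \<mapsto> x + y s\<close>.\<close>

definition Aff :: "(real \<times> real) set" where
  "Aff = {q. snd q > 0}"

definition aff_mult :: "real \<times> real \<Rightarrow> real \<times> real \<Rightarrow> real \<times> real" where
  "aff_mult q p = (fst q + snd q * fst p, snd q * snd p)"

definition aff_id :: "real \<times> real" where
  "aff_id = (0, 1)"

definition X1 :: "real \<times> real \<Rightarrow> real \<times> real" where
  "X1 q = (snd q, 0)"

definition X2 :: "real \<times> real \<Rightarrow> real \<times> real" where
  "X2 q = (0, snd q)"

lemma left_translation_derivative:
  "(aff_mult q has_derivative (\<lambda>w. (snd q * fst w, snd q * snd w))) (at p)"
  unfolding aff_mult_def by (auto intro!: derivative_eq_intros)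

lemma frame_left_invariant:
  "frechet_derivative (aff_mult q) (at p) (X1 p) = X1 (aff_mult q p)"
  "frechet_derivative (aff_mult q) (at p) (X2 p) = X2 (aff_mult q p)"
  using frechet_derivative_at[OF left_translation_derivative[of q p], symmetric]
  by (simp_all add: X1_def X2_def aff_mult_def)

definition frame_coords :: "real \<times> real \<Rightarrow> real \<times> real \<Rightarrow> real ^ 2" where
  "frame_coords q w = vector [fst w / snd q, snd w / snd q]"

lemma frame_coords_expansion:
  assumes "q \<in> Aff"
  shows "frame_coords q w $ 1 *\<^sub>R X1 q + frame_coords q w $ 2 *\<^sub>R X2 q = w"
  using assms by (simp add: Aff_def frame_coords_def X1_def X2_def prod_eq_iff)

text \<open>The vector \<open>(v\<^sub>1, v\<^sub>2)\<close> attached to a tangent vector \<open>w\<close> at \<open>q\<close>.\<close>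

definition lor_coords :: "real ^ 2 ^ 2 \<Rightarrow> real \<times> real \<Rightarrow> real \<times> real \<Rightarrow> real ^ 2" where
  "lor_coords A q w = A *v frame_coords q w"

definition lor_form :: "real ^ 2 ^ 2 \<Rightarrow> real \<times> real \<Rightarrow> real \<times> real \<Rightarrow> real" where
  "lor_form A q w = - (lor_coords A q w $ 1)\<^sup>2 + (lor_coords A q w $ 2)\<^sup>2"

definition future_nonspacelike :: "real ^ 2 ^ 2 \<Rightarrow> real \<times> real \<Rightarrow> real \<times> real \<Rightarrow> bool" where
  "future_nonspacelike A q w \<longleftrightarrow> lor_coords A q w $ 1 \<ge> \<bar>lor_coords A q w $ 2\<bar>"

text \<open>The sectional curvature of a left-invariant Lorentzian form on this two-dimensional group is
  the same at every point; this is its value in terms of the matrix.\<close>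

definition sectional_curvature :: "real ^ 2 ^ 2 \<Rightarrow> real" where
  "sectional_curvature A = ((A $ 2 $ 1)\<^sup>2 - (A $ 1 $ 1)\<^sup>2) / (det A)\<^sup>2"

text \<open>A curve is a function on \<open>real\<close> of which only the values on \<open>{0..t1}\<close> matter. Its image is a
  compact subset of the open half-plane, so being Lipschitz for the Euclidean distance is the same
  as being Lipschitz for any Riemannian metric on the group.\<close>

definition velocity :: "real \<Rightarrow> (real \<Rightarrow> real \<times> real) \<Rightarrow> real \<Rightarrow> real \<times> real" where
  "velocity t1 q t = vector_derivative q (at t within {0..t1})"

definition nonspacelike_curve :: "real ^ 2 ^ 2 \<Rightarrow> real \<Rightarrow> (real \<Rightarrow> real \<times> real) \<Rightarrow> bool" where
  "nonspacelike_curve A t1 q \<longleftrightarrow>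
     0 < t1 \<and> q ` {0..t1} \<subseteq> Aff \<and> (\<exists>L. L-lipschitz_on {0..t1} q) \<and>
     (AE t\<in>{0..t1} in lebesgue. q differentiable (at t within {0..t1}) \<and>
        future_nonspacelike A (q t) (velocity t1 q t))"

definition nonspacelike_curve_from_to ::
  "real ^ 2 ^ 2 \<Rightarrow> real \<times> real \<Rightarrow> real \<times> real \<Rightarrow> real \<Rightarrow> (real \<Rightarrow> real \<times> real) \<Rightarrow> bool" where
  "nonspacelike_curve_from_to A q0 q1 t1 q \<longleftrightarrow>
     nonspacelike_curve A t1 q \<and> q 0 = q0 \<and> q t1 = q1"

text \<open>The integrand is defined, bounded and measurable up to a null set, so the integral exists
  and agrees with the Lebesgue integral.\<close>

definition lor_length :: "real ^ 2 ^ 2 \<Rightarrow> real \<Rightarrow> (real \<Rightarrow> real \<times> real) \<Rightarrow> real" where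
  "lor_length A t1 q = integral {0..t1} (\<lambda>t. sqrt (- lor_form A (q t) (velocity t1 q t)))"

definition causal_future :: "real ^ 2 ^ 2 \<Rightarrow> real \<times> real \<Rightarrow> (real \<times> real) set" where
  "causal_future A q0 = {q1. \<exists>t1 q. nonspacelike_curve_from_to A q0 q1 t1 q}"

text \<open>Only meaningful for \<open>q1 \<in> causal_future A q0\<close>; otherwise the supremum is over the empty set.\<close>

definition lor_dist :: "real ^ 2 ^ 2 \<Rightarrow> real \<times> real \<Rightarrow> real \<times> real \<Rightarrow> ereal" where
  "lor_dist A q0 q1 = Sup {ereal (lor_length A t1 q) | t1 q. nonspacelike_curve_from_to A q0 q1 t1 q}"

text \<open>Since \<open>lor_length\<close> is real-valued, the equation forces the supremum to be finite.\<close>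

definition length_maximizer ::
  "real ^ 2 ^ 2 \<Rightarrow> real \<times> real \<Rightarrow> real \<times> real \<Rightarrow> real \<Rightarrow> (real \<Rightarrow> real \<times> real) \<Rightarrow> bool" where
  "length_maximizer A q0 q1 t1 q \<longleftrightarrow>
     nonspacelike_curve_from_to A q0 q1 t1 q \<and> ereal (lor_length A t1 q) = lor_dist A q0 q1"

definition lambda1 :: "real ^ 2 ^ 2 \<Rightarrow> real \<times> real \<Rightarrow> real" where
  "lambda1 A q = (A $ 2 $ 1 - A $ 1 $ 1) * fst q + (A $ 2 $ 2 - A $ 1 $ 2) * (snd q - 1)"

definition lambda2 :: "real ^ 2 ^ 2 \<Rightarrow> real \<times> real \<Rightarrow> real" where
  "lambda2 A q = (A $ 2 $ 1 + A $ 1 $ 1) * fst q + (A $ 2 $ 2 + A $ 1 $ 2) * (snd q - 1)"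

text \<open>The denominator is positive when \<open>a \<ge> 0\<close> and the sectional curvature is negative.\<close>

definition ptB :: "real ^ 2 ^ 2 \<Rightarrow> real \<times> real" where
  "ptB A = ((A $ 2 $ 2 + A $ 1 $ 2) / (A $ 2 $ 1 + A $ 1 $ 1), 0)"

definition lambda3 :: "real ^ 2 ^ 2 \<Rightarrow> real \<times> real \<Rightarrow> real" where
  "lambda3 A q = lambda1 A q - lambda1 A (ptB A)"

definition regionD :: "real ^ 2 ^ 2 \<Rightarrow> (real \<times> real) set" where
  "regionD A = {q \<in> Aff. lambda1 A q \<le> 0 \<and> 0 \<le> lambda2 A q \<and> lambda3 A q > 0}"

definition regionE :: "real ^ 2 ^ 2 \<Rightarrow> (real \<times> real) set" where
  "regionE A = {q \<in> Aff. lambda3 A q < 0}"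

end

theory Submission
  imports Defs
begin

text \<open>In negative curvature, suitable multiples \<open>u - 1\<close> of \<open>lambda1\<close> and \<open>w\<close> of \<open>lambda2\<close> are null
  coordinates with \<open>u + w = y\<close>. A curve is causal iff \<open>u\<close> does not increase and \<open>w\<close> does not
  decrease, and up to a constant its length is the integral of \<open>sqrt (- u' w') / (u + w)\<close>; the identity
  is \<open>(1, 0)\<close>. This is the half-plane \<open>u + w > 0\<close> with an anti-de Sitter metric that blows up at the
  boundary \<open>u + w = 0\<close>. The point \<open>B\<close> is \<open>(0, 0)\<close>, so \<open>D\<close> is the part of the future where \<open>u > 0\<close> and
  \<open>E\<close> the part where \<open>u < 0\<close>.

  A curve to a point with \<open>u > 0\<close> is confined to a rectangle away from the boundary. There the
  projective substitution \<open>g = 1 / u - 1\<close>, \<open>h = w / (1 + w)\<close> gives the integrand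
  \<open>sqrt (g' h') / (1 + g h)\<close>, which is at most the derivative of \<open>arctan (sqrt (g h))\<close> because
  \<open>2 sqrt (g' h' g h) \<le> g' h + g h'\<close>. This bounds the length of every curve by a function of its
  endpoint (\<open>lor_length_le\<close>), and the bound is attained by the rays \<open>g / h = const\<close>
  (\<open>maximizing_geodesic\<close>). Integrating along merely Lipschitz curves rests on the fundamental theorem of
  calculus for Lipschitz functions that are differentiable off a negligible set
  (\<open>lipschitz_fundamental_theorem_of_calculus\<close>).

  A curve to a point with \<open>u < 0\<close> can instead run along the boundary at any height \<open>y = e\<close> for a
  coordinate time that does not shrink with \<open>e\<close>, which makes its length of order \<open>1 / e\<close>
  (\<open>arbitrarily_long_curve\<close>).\<close>

section \<open>Lipschitz functions differentiable almost everywhere\<close>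

text \<open>The Riemann sums of \<open>f'\<close> telescope to \<open>f b - f a\<close> up to the error of each tagged interval
  \<open>(x, K)\<close>. Off \<open>N\<close> that error is small compared with the length of \<open>K\<close> by differentiability at the
  tag. On \<open>N\<close> it is only bounded by \<open>L\<close> times that length, but the total length of the intervals
  tagged in \<open>N\<close> is a Riemann sum of the indicator function of \<open>N\<close>, so a fine enough gauge makes it
  small as well.\<close>

lemma lipschitz_fundamental_theorem_of_calculus:
  fixes f :: "real \<Rightarrow> 'a::banach"
  assumes ab: "a \<le> b" and lip: "L-lipschitz_on {a..b} f" and N: "negligible N"
    and deriv: "\<And>x. x \<in> {a..b} - N \<Longrightarrow> (f has_vector_derivative f' x) (at x within {a..b})"
  shows "(f' has_integral (f b - f a)) {a..b}"
proof -
  define g where "g x = (if x \<in> N then 0 else f' x)" for x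
  have L0: "0 \<le> L"
    using lip by (rule lipschitz_on_nonneg)
  have "(g has_integral (f b - f a)) {a..b}"
    unfolding has_integral_factor_content_real
  proof (intro allI impI)
    fix e :: real
    assume e: "e > 0"
    have "\<exists>d>0. x \<in> {a..b} - N \<longrightarrow>
         (\<forall>y\<in>{a..b}. norm (y-x) < d \<longrightarrow> norm (f y - f x - (y-x) *\<^sub>R f' x) \<le> e / 2 * norm (y-x))" for x
    proof (cases "x \<in> {a..b} - N")
      case True
      then show ?thesis
        using deriv[OF True] e half_gt_zero[OF e]
        unfolding has_vector_derivative_def has_derivative_within_alt by blast
    qed (use zero_less_one in blast)
    then obtain d where d: "\<And>x. 0 < d x"
      "\<And>x y. \<lbrakk>x \<in> {a..b} - N; y \<in> {a..b}; norm (y-x) < d x\<rbrakk>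
          \<Longrightarrow> norm (f y - f x - (y-x) *\<^sub>R f' x) \<le> e / 2 * norm (y-x)"
      by metis
    \<comment> \<open>The gauge that controls the intervals tagged in \<open>N\<close>.\<close>
    have "((indicator N :: real \<Rightarrow> real) has_integral 0) {a..b}"
      using N unfolding negligible_def by (metis box_real(2))
    moreover have "e / (2 * (L + 1)) > 0"
      using e L0 by simp
    ultimately have "\<exists>D. gauge D \<and> (\<forall>p. p tagged_division_of {a..b} \<and> D fine p \<longrightarrow>
        norm ((\<Sum>(x, K)\<in>p. measure lborel K *\<^sub>R (indicator N x :: real)) - 0)
          \<le> e / (2 * (L + 1)) * measure lborel {a..b})"
      unfolding has_integral_factor_content_real by (elim allE impE)
    then obtain D where D: "gauge D" and D_sum: "\<forall>p. p tagged_division_of {a..b} \<and> D fine p \<longrightarrow>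
        norm ((\<Sum>(x, K)\<in>p. measure lborel K *\<^sub>R (indicator N x :: real)) - 0)
          \<le> e / (2 * (L + 1)) * measure lborel {a..b}"
      by (elim exE conjE) (rule that)
    show "\<exists>d. gauge d \<and> (\<forall>p. p tagged_division_of {a..b} \<and> d fine p \<longrightarrow>
      norm ((\<Sum>(x, K)\<in>p. measure lborel K *\<^sub>R g x) - (f b - f a)) \<le> e * measure lborel {a..b})"
    proof (rule exI, safe)
      show "gauge (\<lambda>x. ball x (d x) \<inter> D x)"
        by (intro gauge_Int gauge_ball_dependent allI d(1) D)
    next
      fix p
      assume ptag: "p tagged_division_of {a..b}" and fine: "(\<lambda>x. ball x (d x) \<inter> D x) fine p"
      have fine1: "(\<lambda>x. ball x (d x)) fine p" and fine2: "D fine p"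
        using fine by (auto simp: fine_Int)
      have ba: "f b - f a = (\<Sum>(x,K)\<in>p. f (Sup K) - f (Inf K))"
        using additive_tagged_division_1[OF ab ptag, of f] by auto
      have piece: "norm (measure lborel K *\<^sub>R g x - (f (Sup K) - f (Inf K)))
          \<le> e / 2 * measure lborel K + L * (measure lborel K *\<^sub>R indicator N x)" if xK: "(x, K) \<in> p" for x K
      proof -
        obtain u v where k: "K = cbox u v"
          using ptag xK by blast
        have xin: "x \<in> K" and kab: "K \<subseteq> {a..b}"
          using ptag xK by blast+
        have uv: "u \<le> v"
          using xin k by auto
        have in_ab: "x \<in> {a..b}" "u \<in> {a..b}" "v \<in> {a..b}"
          using kab xin uv by (auto simp: k)
        show ?thesis
        proof (cases "x \<in> N")
          case True
          have "norm (f v - f u) \<le> L * norm (v - u)"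
            using lipschitz_on_normD[OF lip in_ab(3,2)] .
          then show ?thesis
            using True uv e by (simp add: g_def k norm_minus_commute add_increasing)
        next
          case False
          have ball: "K \<subseteq> ball x (d x)"
            using fine1 xK by blast
          have "norm ((v - u) *\<^sub>R f' x - (f v - f u))
              = norm (f u - f x - (u - x) *\<^sub>R f' x - (f v - f x - (v - x) *\<^sub>R f' x))"
            by (simp add: algebra_simps)
          also have "\<dots> \<le> norm (f u - f x - (u - x) *\<^sub>R f' x) + norm (f v - f x - (v - x) *\<^sub>R f' x)"
            by (rule norm_triangle_ineq4)
          also have "\<dots> \<le> e / 2 * norm (u - x) + e / 2 * norm (v - x)"
            using ball uv by (intro add_mono d) (use False in_ab in \<open>auto simp: k dist_real_def subset_iff\<close>)
          also have "\<dots> = e / 2 * (v - u)"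
            using xin by (auto simp: k field_simps)
          finally show ?thesis
            using uv False by (simp add: g_def k)
        qed
      qed
      have "norm ((\<Sum>(x, K)\<in>p. measure lborel K *\<^sub>R g x) - (f b - f a))
          = norm (\<Sum>(x, K)\<in>p. measure lborel K *\<^sub>R g x - (f (Sup K) - f (Inf K)))"
        by (simp add: ba split_def sum_subtractf)
      also have "\<dots> \<le> (\<Sum>(x, K)\<in>p. e / 2 * measure lborel K + L * (measure lborel K *\<^sub>R indicator N x))"
        by (intro sum_norm_le) (use piece in auto)
      also have "\<dots> = e / 2 * (\<Sum>(x, K)\<in>p. measure lborel K)
          + L * (\<Sum>(x, K)\<in>p. measure lborel K *\<^sub>R indicator N x)"
        by (simp add: split_def sum.distrib sum_distrib_left)
      also have "\<dots> \<le> e / 2 * measure lborel {a..b} + L * (e / (2 * (L + 1)) * measure lborel {a..b})"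
        using additive_content_tagged_division[of p a b] ptag D_sum[rule_format, OF conjI[OF ptag fine2]] L0 e
        by (intro add_mono mult_left_mono) auto
      also have "\<dots> = (e / 2 + L * (e / (2 * (L + 1)))) * measure lborel {a..b}"
        by (simp only: distrib_right mult.assoc)
      also have "\<dots> \<le> e * measure lborel {a..b}"
      proof (rule mult_right_mono)
        show "e / 2 + L * (e / (2 * (L + 1))) \<le> e"
          using L0 e by (simp add: field_simps)
      qed simp
      finally show "norm ((\<Sum>(x, K)\<in>p. measure lborel K *\<^sub>R g x) - (f b - f a)) \<le> e * measure lborel {a..b}" .
    qed
  qed
  then show ?thesis
    by (rule has_integral_spike[OF N, rotated]) (simp add: g_def)
qed

corollary lipschitz_nondecreasing_if_deriv_nonneg:
  fixes f :: "real \<Rightarrow> real"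
  assumes "L-lipschitz_on {a..b} f" "negligible N"
    and deriv: "\<And>x. x \<in> {a..b} - N \<Longrightarrow>
      (f has_vector_derivative f' x) (at x within {a..b}) \<and> 0 \<le> f' x"
    and xy: "a \<le> x" "x \<le> y" "y \<le> b"
  shows "f x \<le> f y"
proof -
  have sub: "{x..y} \<subseteq> {a..b}"
    using xy by auto
  have "(f' has_integral (f y - f x)) {x..y}"
  proof (rule lipschitz_fundamental_theorem_of_calculus[OF xy(2) _ assms(2)])
    show "L-lipschitz_on {x..y} f"
      using assms(1) sub by (rule lipschitz_on_subset)
    show "(f has_vector_derivative f' t) (at t within {x..y})" if "t \<in> {x..y} - N" for t
      using deriv[of t] that sub by (auto intro: has_vector_derivative_within_subset[OF _ sub])
  qed
  then have "((\<lambda>t. if t \<in> N then 0 else f' t) has_integral (f y - f x)) {x..y}"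
    by (rule has_integral_spike[OF assms(2), rotated]) simp
  then have "0 \<le> f y - f x"
    by (rule has_integral_nonneg) (use deriv sub in auto)
  then show ?thesis
    by simp
qed

section \<open>Calibration by the distance function\<close>

lemma lipschitz_on_if_bounded_real_derivative:
  fixes f :: "real \<Rightarrow> real"
  assumes "convex S" "0 \<le> C"
    and "\<And>x. x \<in> S \<Longrightarrow> (f has_real_derivative f' x) (at x within S)"
    and "\<And>x. x \<in> S \<Longrightarrow> \<bar>f' x\<bar> \<le> C"
  shows "C-lipschitz_on S f"
  using field_differentiable_bound[OF assms(1), of f f' C] assms(2-)
  by (intro lipschitz_onI) (auto simp: dist_norm)

text \<open>The arithmetic-geometric inequality behind the calibration of the next lemma: the right-hand side
  is the derivative of \<open>sqrt (G * H)\<close> when \<open>p\<close> and \<open>q\<close> are the derivatives of \<open>G\<close> and \<open>H\<close>.\<close>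

lemma sqrt_mult_le_calibration_derivative:
  fixes p q G H :: real
  assumes "0 \<le> p" "0 \<le> q" "0 < G" "0 < H"
  shows "sqrt (p * q) \<le> sqrt (G * H) / 2 * (p / G + q / H)"
proof -
  have "sqrt ((p / G) * (q / H)) \<le> (p / G + q / H) / 2"
    using assms by (intro arith_geo_mean_sqrt) auto
  then have "sqrt (G * H) * sqrt ((p / G) * (q / H)) \<le> sqrt (G * H) * ((p / G + q / H) / 2)"
    using assms by (intro mult_left_mono) auto
  then show ?thesis
    using assms by (simp flip: real_sqrt_mult)
qed

text \<open>In these coordinates the Lorentzian distance from the origin is \<open>arctan (sqrt (g * h))\<close>. Where
  \<open>g\<close> and \<open>h\<close> are positive, its derivative along the curve dominates the integrand by the
  arithmetic-geometric inequality. It is singular where \<open>g * h = 0\<close>, in particular at the start of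
  the curves of interest, so that its composition with the curve need not be Lipschitz. Hence \<open>g\<close> and
  \<open>h\<close> are shifted by \<open>e > 0\<close>; this changes the denominator \<open>1 + g * h\<close> by a factor that tends to
  \<open>1\<close> as \<open>e\<close> tends to \<open>0\<close>.\<close>

lemma arctan_length_bound:
  fixes g h g' h' :: "real \<Rightarrow> real"
  assumes T: "0 \<le> T" and lip: "L-lipschitz_on {0..T} g" "M-lipschitz_on {0..T} h" 
    and N: "negligible N"
    and deriv: "\<And>t. t \<in> {0..T} - N \<Longrightarrow> (g has_vector_derivative g' t) (at t within {0..T}) \<and>
      (h has_vector_derivative h' t) (at t within {0..T}) \<and> 0 \<le> g' t \<and> 0 \<le> h' t"
    and start: "0 \<le> g 0" "0 \<le> h 0"
  shows "integral {0..T} (\<lambda>t. sqrt (g' t * h' t) / (1 + g t * h t)) \<le> arctan (sqrt (g T * h T))"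
proof (cases "(\<lambda>t. sqrt (g' t * h' t) / (1 + g t * h t)) integrable_on {0..T}")
  case False
  \<comment> \<open>Then \<open>integral\<close> has its default value \<open>0\<close>.\<close>
  have "0 \<le> g T" "0 \<le> h T"
    using lipschitz_nondecreasing_if_deriv_nonneg[OF lip(1) N, of g' 0 T]
      lipschitz_nondecreasing_if_deriv_nonneg[OF lip(2) N, of h' 0 T] deriv start T by auto
  with False show ?thesis
    by (simp add: not_integrable_integral)
next
  case True
  let ?I = "integral {0..T} (\<lambda>t. sqrt (g' t * h' t) / (1 + g t * h t))"
  have mono_g: "g s \<le> g t" if "0 \<le> s" "s \<le> t" "t \<le> T" for s t
    using lipschitz_nondecreasing_if_deriv_nonneg[OF lip(1) N, of g' s t] deriv that by auto
  have mono_h: "h s \<le> h t" if "0 \<le> s" "s \<le> t" "t \<le> T" for s t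
    using lipschitz_nondecreasing_if_deriv_nonneg[OF lip(2) N, of h' s t] deriv that by auto
  have g_bounds: "0 \<le> g t" "g t \<le> g T" and h_bounds: "0 \<le> h t" "h t \<le> h T"
    if "t \<in> {0..T}" for t
    using mono_g[of 0 t] mono_g[of t T] mono_h[of 0 t] mono_h[of t T] start that by auto
  have shifted: "?I \<le> (1 + e * (g T + h T + e)) * arctan (sqrt ((g T + e) * (h T + e)))"
    if e: "0 < e" for e :: real
  proof -
    \<comment> \<open>Writing \<open>sqrt (G * H)\<close> as \<open>exp ((ln G + ln H) / 2)\<close> makes \<open>F\<close> a composition of Lipschitz
      functions, without Lipschitz estimates for products.\<close>
    define F where "F t = arctan (exp ((ln (g t + e) + ln (h t + e)) / 2))" for t
    define F' where "F' t = sqrt ((g t + e) * (h t + e)) / 2 * (g' t / (g t + e) + h' t / (h t + e))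
        / (1 + (g t + e) * (h t + e))" for t
    have F_eq: "F t = arctan (sqrt ((g t + e) * (h t + e)))"
      and exp_eq: "exp ((ln (g t + e) + ln (h t + e)) / 2) = sqrt ((g t + e) * (h t + e))"
      if "t \<in> {0..T}" for t
    proof -
      have pos: "0 < g t + e" "0 < h t + e"
        using g_bounds h_bounds that e by (auto simp: add_nonneg_pos)
      have "exp ((ln (g t + e) + ln (h t + e)) / 2) ^ 2 = exp (ln (g t + e) + ln (h t + e))"
        by (simp only: power2_eq_square mult_exp_exp field_sum_of_halves)
      also have "\<dots> = (g t + e) * (h t + e)"
        using pos by (simp add: exp_add)
      finally have "exp ((ln (g t + e) + ln (h t + e)) / 2) ^ 2 = (g t + e) * (h t + e)" .
      then show "exp ((ln (g t + e) + ln (h t + e)) / 2) = sqrt ((g t + e) * (h t + e))"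
        by (metis exp_ge_zero real_sqrt_unique)
      then show "F t = arctan (sqrt ((g t + e) * (h t + e)))"
        by (simp add: F_def)
    qed
    have lip_ln: "(1 / e)-lipschitz_on {e..} ln"
      using e by (intro lipschitz_on_if_bounded_real_derivative[where f' = inverse])
        (auto intro!: derivative_eq_intros simp: field_simps)
    have deriv_arctan_exp: "((\<lambda>s. arctan (exp (s / 2))) has_real_derivative
        exp (s / 2) / 2 / (1 + (exp (s / 2))\<^sup>2)) (at s within S)" for s :: real and S
      by (auto intro!: derivative_eq_intros simp: divide_simps)
    have lip_arctan: "1-lipschitz_on UNIV (\<lambda>s. arctan (exp (s / 2)) :: real)"
    proof (rule lipschitz_on_if_bounded_real_derivative[OF _ _ deriv_arctan_exp])
      show "\<bar>exp (s / 2) / 2 / (1 + (exp (s / 2))\<^sup>2)\<bar> \<le> 1" for s :: real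
      proof -
        have "0 \<le> (1 - exp (s / 2))\<^sup>2 + (exp (s / 2))\<^sup>2"
          by simp
        then have "2 * exp (s / 2) \<le> 1 + 2 * (exp (s / 2))\<^sup>2"
          by (simp only: power2_diff) simp
        then have "exp (s / 2) / 2 \<le> 1 + (exp (s / 2))\<^sup>2"
          using exp_ge_zero[of "s / 2"] by linarith
        then show ?thesis
          by (simp add: abs_of_nonneg divide_le_eq add_pos_nonneg)
      qed
    qed auto
    have lip_ln_shift: "(1 / e * C)-lipschitz_on {0..T} (\<lambda>t. ln (k t + e))"
      if "C-lipschitz_on {0..T} k" and "\<And>t. t \<in> {0..T} \<Longrightarrow> 0 \<le> k t" for C k
    proof (rule lipschitz_on_compose2[where f = "\<lambda>t. k t + e" and g = ln])
      show "C-lipschitz_on {0..T} (\<lambda>t. k t + e)"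
        using lipschitz_on_add[OF that(1) lipschitz_on_constant[of _ e]] by simp
      show "(1 / e)-lipschitz_on ((\<lambda>t. k t + e) ` {0..T}) ln"
        using that(2) by (intro lipschitz_on_subset[OF lip_ln]) auto
    qed
    have lip_F: "(1 * (1 / e * L + 1 / e * M))-lipschitz_on {0..T} F"
      unfolding F_def
    proof (rule lipschitz_on_compose2[where f = "\<lambda>t. ln (g t + e) + ln (h t + e)"
          and g = "\<lambda>s. arctan (exp (s / 2))"])
      show "(1 / e * L + 1 / e * M)-lipschitz_on {0..T} (\<lambda>t. ln (g t + e) + ln (h t + e))"
        using g_bounds h_bounds by (intro lipschitz_on_add lip_ln_shift lip)
      show "1-lipschitz_on ((\<lambda>t. ln (g t + e) + ln (h t + e)) ` {0..T}) (\<lambda>s. arctan (exp (s / 2)))"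
        by (rule lipschitz_on_subset[OF lip_arctan]) simp
    qed
    have deriv_F: "(F has_vector_derivative F' t) (at t within {0..T})" if t: "t \<in> {0..T} - N" for t
    proof -
      have pos: "0 < g t + e" "0 < h t + e"
        using g_bounds[of t] h_bounds[of t] t e by auto
      have d: "(g has_real_derivative g' t) (at t within {0..T})"
        "(h has_real_derivative h' t) (at t within {0..T})"
        using deriv[OF t] by (auto simp: has_real_derivative_iff_has_vector_derivative)
      have "((\<lambda>t. ln (k t + e)) has_real_derivative k' / (k t + e)) (at t within {0..T})"
        if "(k has_real_derivative k') (at t within {0..T})" "0 < k t + e" for k k'
      proof -
        have "((\<lambda>t. k t + e) has_real_derivative k') (at t within {0..T})"
          using DERIV_add[OF that(1) DERIV_const[of e]] by simp
        from DERIV_chain2[OF DERIV_ln[OF that(2)] this] show ?thesis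
          by (simp add: divide_inverse mult.commute)
      qed
      then have "((\<lambda>t. ln (g t + e) + ln (h t + e)) has_real_derivative
          g' t / (g t + e) + h' t / (h t + e)) (at t within {0..T})"
        using d pos by (intro DERIV_add) auto
      from DERIV_chain2[OF deriv_arctan_exp this]
      have "(F has_real_derivative F' t) (at t within {0..T})"
        using exp_eq[of t] t pos by (simp add: F_def[abs_def] F'_def)
      then show ?thesis
        by (simp add: has_real_derivative_iff_has_vector_derivative)
    qed
    have int_F: "(F' has_integral (F T - F 0)) {0..T}"
      using lipschitz_fundamental_theorem_of_calculus[OF T lip_F N deriv_F] .
    define K where "K = 1 + e * (g T + h T + e)"
    have le: "sqrt (g' t * h' t) / (1 + g t * h t) \<le> K * F' t" if t: "t \<in> {0..T} - N" for t
    proof -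
      define X where "X = (g t + e) * (h t + e)"
      have pos: "0 < g t + e" "0 < h t + e" "0 \<le> g t * h t"
        using g_bounds[of t] h_bounds[of t] t e by auto
      then have X: "0 < X"
        by (simp add: X_def)
      have "X = g t * h t + e * (g t + h t + e)"
        by (simp add: X_def algebra_simps)
      also have "\<dots> \<le> g t * h t + e * (g T + h T + e)"
        using g_bounds[of t] h_bounds[of t] t e by (intro add_left_mono mult_left_mono) auto
      finally have "1 + X \<le> 1 + g t * h t + (K - 1) * 1"
        by (simp add: K_def)
      also have "\<dots> \<le> 1 + g t * h t + (K - 1) * (1 + g t * h t)"
        using pos g_bounds[of T] h_bounds[of T] T e by (intro add_left_mono mult_left_mono) (auto simp: K_def)
      finally have KX: "1 + X \<le> K * (1 + g t * h t)"
        by (simp add: algebra_simps)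
      have K0: "0 \<le> K"
        using g_bounds[of T] h_bounds[of T] T e by (simp add: K_def)
      have "1 / (1 + g t * h t) \<le> K / (1 + X)"
        using KX X pos frac_le_eq[of "1 + g t * h t" "1 + X" 1 K] by (simp add: divide_le_0_iff)
      from mult_left_mono[OF this, of "sqrt (g' t * h' t)"]
      have "sqrt (g' t * h' t) / (1 + g t * h t) \<le> sqrt (g' t * h' t) * (K / (1 + X))"
        using deriv[OF t] by simp
      also have "\<dots> \<le> (sqrt X / 2 * (g' t / (g t + e) + h' t / (h t + e))) * (K / (1 + X))"
        using deriv[OF t] pos X K0 unfolding X_def
        by (intro mult_right_mono sqrt_mult_le_calibration_derivative) auto
      also have "\<dots> = K * F' t"
        by (simp add: F'_def X_def)
      finally show ?thesis .
    qed
    have "?I \<le> K * (F T - F 0)"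
    proof -
      have "((\<lambda>t. K * F' t) has_integral (K * (F T - F 0))) {0..T}"
        using has_integral_mult_right[OF int_F] .
      then have 1: "((\<lambda>t. if t \<in> N then 0 else K * F' t) has_integral (K * (F T - F 0))) {0..T}"
        by (rule has_integral_spike[OF N, rotated]) simp
      have "((\<lambda>t. if t \<in> N then 0 else sqrt (g' t * h' t) / (1 + g t * h t)) has_integral ?I) {0..T}"
        by (rule has_integral_spike[OF N _ integrable_integral[OF True]]) simp
      from has_integral_le[OF this 1] show ?thesis
        using le by auto
    qed
    also have "\<dots> \<le> K * F T"
    proof (rule mult_left_mono)
      show "F T - F 0 \<le> F T"
        by (simp add: F_def)
      show "0 \<le> K"
        using g_bounds[of T] h_bounds[of T] T e by (simp add: K_def)
    qed
    finally show ?thesis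
      using T by (simp add: K_def F_eq)
  qed
  have "((\<lambda>e. (1 + e * (g T + h T + e)) * arctan (sqrt ((g T + e) * (h T + e)))) \<longlongrightarrow>
      (1 + 0 * (g T + h T + 0)) * arctan (sqrt ((g T + 0) * (h T + 0)))) (at_right 0)"
    by (intro tendsto_intros)
  moreover have "\<forall>\<^sub>F e in at_right 0. ?I \<le> (1 + e * (g T + h T + e)) * arctan (sqrt ((g T + e) * (h T + e)))"
    using shifted by (auto simp: eventually_at_right_field intro!: exI[of _ 1])
  ultimately show ?thesis
    using tendsto_lowerbound[of _ _ "at_right (0::real)" ?I] by fastforce
qed

text \<open>The projective substitution \<open>g = 1 / u - 1\<close>, \<open>h = w / (1 + w)\<close> moves the starting point \<open>(1, 0)\<close>
  to the origin and turns \<open>- du dw / (u + w)\<^sup>2\<close> into \<open>dg dh / (1 + g h)\<^sup>2\<close>. It is regular on the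
  rectangle \<open>u T \<le> u \<le> 1\<close>, \<open>0 \<le> w \<le> w T\<close>, to which monotonicity confines the curve; this is where
  \<open>0 < u T\<close> enters.\<close>

lemma null_length_bound:
  fixes u w u' w' :: "real \<Rightarrow> real"
  assumes T: "0 \<le> T" and lip: "L-lipschitz_on {0..T} u" "M-lipschitz_on {0..T} w" 
    and N: "negligible N"
    and deriv: "\<And>t. t \<in> {0..T} - N \<Longrightarrow> (u has_vector_derivative u' t) (at t within {0..T}) \<and>
      (w has_vector_derivative w' t) (at t within {0..T}) \<and> u' t \<le> 0 \<and> 0 \<le> w' t"
    and ends: "u 0 = 1" "w 0 = 0" "0 < u T"
  shows "integral {0..T} (\<lambda>t. sqrt (- u' t * w' t) / (u t + w t))
    \<le> arctan (sqrt ((1 / u T - 1) * (w T / (1 + w T))))"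
proof -
  have u_mono: "- u s \<le> - u t" if "0 \<le> s" "s \<le> t" "t \<le> T" for s t
    using lipschitz_nondecreasing_if_deriv_nonneg[of L 0 T "\<lambda>t. - u t" N "\<lambda>t. - u' t" s t]
      lip N deriv that by (auto intro: has_vector_derivative_minus)
  have w_mono: "w s \<le> w t" if "0 \<le> s" "s \<le> t" "t \<le> T" for s t
    using lipschitz_nondecreasing_if_deriv_nonneg[OF lip(2) N, of w' s t] deriv that by auto
  have u_bounds: "u T \<le> u t" and w_nonneg: "0 \<le> w t" if "t \<in> {0..T}" for t
    using u_mono[of t T] w_mono[of 0 t] ends that by auto
  have lip_inverse: "(inverse (r\<^sup>2) * C)-lipschitz_on {0..T} (\<lambda>t. inverse (k t))"
    if k: "C-lipschitz_on {0..T} k" "\<And>t. t \<in> {0..T} \<Longrightarrow> r \<le> k t" and r: "0 < r"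
    for C r :: real and k :: "real \<Rightarrow> real"
  proof (rule lipschitz_on_compose2[where f = k and g = inverse])
    show "C-lipschitz_on {0..T} k" by fact
    have "(inverse (r\<^sup>2))-lipschitz_on {r..} (inverse :: real \<Rightarrow> real)"
    proof (rule lipschitz_on_if_bounded_real_derivative)
      show "(inverse has_real_derivative - (inverse x ^ Suc (Suc 0))) (at x within {r..})"
        if "x \<in> {r..}" for x
        using that r by (intro DERIV_inverse) auto
      show "\<bar>- (inverse x ^ Suc (Suc 0))\<bar> \<le> inverse (r\<^sup>2)" if "x \<in> {r..}" for x
        using that r power_mono[of "inverse x" "inverse r" 2]
        by (simp add: power_inverse le_imp_inverse_le numeral_2_eq_2)
    qed auto
    then show "(inverse (r\<^sup>2))-lipschitz_on (k ` {0..T}) inverse"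
      by (rule lipschitz_on_subset) (use k in auto)
  qed
  define g h where "g t = inverse (u t) - 1" and "h t = 1 - inverse (1 + w t)" for t
  define g' h' where "g' t = - u' t / (u t)\<^sup>2" and "h' t = w' t / (1 + w t)\<^sup>2" for t
  have "integral {0..T} (\<lambda>t. sqrt (g' t * h' t) / (1 + g t * h t)) \<le> arctan (sqrt (g T * h T))"
  proof (rule arctan_length_bound[OF T _ _ N])
    show "(inverse ((u T)\<^sup>2) * L + 0)-lipschitz_on {0..T} g"
      unfolding g_def using u_bounds ends
      by (intro lipschitz_on_diff lipschitz_on_constant lip_inverse lip)
    have "(0 + M)-lipschitz_on {0..T} (\<lambda>t. 1 + w t)"
      by (intro lipschitz_on_add lipschitz_on_constant lip)
    then show "(0 + inverse (1\<^sup>2) * (0 + M))-lipschitz_on {0..T} h"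
      unfolding h_def using w_nonneg
      by (intro lipschitz_on_diff lipschitz_on_constant lip_inverse) auto
    fix t assume t: "t \<in> {0..T} - N"
    have pos: "0 < u t" "0 < 1 + w t"
      using u_bounds[of t] w_nonneg[of t] ends t by auto
    have "(u has_real_derivative u' t) (at t within {0..T})"
      "((\<lambda>t. 1 + w t) has_real_derivative 0 + w' t) (at t within {0..T})"
      using deriv[OF t] DERIV_add[OF DERIV_const[of 1], of w "w' t" t "{0..T}"]
      by (auto simp: has_real_derivative_iff_has_vector_derivative)
    from this[THEN DERIV_inverse_fun] pos
    have "((\<lambda>t. inverse (u t)) has_real_derivative g' t) (at t within {0..T})"
      "((\<lambda>t. inverse (1 + w t)) has_real_derivative - h' t) (at t within {0..T})"
      by (auto simp: g'_def h'_def field_simps power2_eq_square)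
    from DERIV_diff[OF this(1) DERIV_const[of 1]] DERIV_diff[OF DERIV_const[of 1] this(2)]
    have "(g has_real_derivative g' t) (at t within {0..T})"
      "(h has_real_derivative h' t) (at t within {0..T})"
      by (simp_all add: g_def[abs_def] h_def[abs_def])
    moreover have "0 \<le> g' t" "0 \<le> h' t"
      using deriv[OF t] by (auto simp: g'_def h'_def divide_nonpos_nonneg)
    ultimately show "(g has_vector_derivative g' t) (at t within {0..T}) \<and>
        (h has_vector_derivative h' t) (at t within {0..T}) \<and> 0 \<le> g' t \<and> 0 \<le> h' t"
      by (simp add: has_real_derivative_iff_has_vector_derivative)
  qed (use ends in \<open>auto simp: g_def h_def\<close>)
  also have "g T = 1 / u T - 1"
    by (simp add: g_def inverse_eq_divide)
  also have "h T = w T / (1 + w T)"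
    using w_nonneg[of T] T by (simp add: h_def field_simps)
  also have "integral {0..T} (\<lambda>t. sqrt (g' t * h' t) / (1 + g t * h t))
      = integral {0..T} (\<lambda>t. sqrt (- u' t * w' t) / (u t + w t))"
  proof (rule integral_cong)
    fix t assume t: "t \<in> {0..T}"
    have pos: "0 < u t" "0 < 1 + w t"
      using u_bounds[of t] w_nonneg[of t] ends t by auto
    have "g' t * h' t = (- u' t * w' t) / (u t * (1 + w t))\<^sup>2"
      by (simp add: g'_def h'_def power_mult_distrib)
    then have 1: "sqrt (g' t * h' t) = sqrt (- u' t * w' t) / (u t * (1 + w t))"
      using pos by (simp only: real_sqrt_divide) simp
    have 2: "1 + g t * h t = (u t + w t) / (u t * (1 + w t))"
      using pos by (simp add: g_def h_def divide_simps) (simp add: algebra_simps)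
    show "sqrt (g' t * h' t) / (1 + g t * h t) = sqrt (- u' t * w' t) / (u t + w t)"
      unfolding 1 2 using pos by simp
  qed
  finally show ?thesis .
qed

section \<open>Null coordinates on the group\<close>

text \<open>For \<open>a \<ge> 0\<close> the curvature is negative iff \<open>\<bar>c\<bar> < a\<close>. Up to positive factors \<open>lambda1\<close> is
  \<open>ucoord - 1\<close> and \<open>lambda2\<close> is \<open>wcoord\<close>; the factors are chosen such that \<open>ucoord + wcoord\<close> is the
  ordinate \<open>y\<close> of the half-plane. The linear parts of these affine functions are \<open>du\<close> and \<open>dw\<close>, and
  \<open>pt\<close> is the inverse coordinate change.\<close>

locale negatively_curved_aff =
  fixes A :: "real ^ 2 ^ 2"
  assumes det_pos: "0 < det A" and abs_c_less_a: "\<bar>A $ 2 $ 1\<bar> < A $ 1 $ 1"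
begin

text \<open>\<open>(- al, be)\<close> and \<open>(ga, de)\<close> are the rows of coefficients of \<open>v\<^sub>2 - v\<^sub>1\<close> and
  \<open>v\<^sub>2 + v\<^sub>1\<close>; \<open>Dt\<close> is twice the determinant of \<open>A\<close>.\<close>

definition al where "al = A $ 1 $ 1 - A $ 2 $ 1"
definition be where "be = A $ 2 $ 2 - A $ 1 $ 2"
definition ga where "ga = A $ 1 $ 1 + A $ 2 $ 1"
definition de where "de = A $ 2 $ 2 + A $ 1 $ 2"
definition Dt where "Dt = ga * be + al * de"

definition ucoord :: "real \<times> real \<Rightarrow> real" where
  "ucoord q = 1 + ga * (- al * fst q + be * (snd q - 1)) / Dt"

definition wcoord :: "real \<times> real \<Rightarrow> real" where
  "wcoord q = al * (ga * fst q + de * (snd q - 1)) / Dt"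

definition du :: "real \<times> real \<Rightarrow> real" where
  "du v = ga * (- al * fst v + be * snd v) / Dt"

definition dw :: "real \<times> real \<Rightarrow> real" where
  "dw v = al * (ga * fst v + de * snd v) / Dt"

definition pt :: "real \<Rightarrow> real \<Rightarrow> real \<times> real" where
  "pt u w = (de * (1 - u) / ga + be * w / al, u + w)"

lemma coeff_pos: "0 < al" "0 < ga" "0 < Dt"
proof -
  show "0 < al" "0 < ga"
    using abs_c_less_a by (auto simp: al_def ga_def)
  have "Dt = 2 * det A"
    by (simp add: Dt_def al_def be_def ga_def de_def det_2 algebra_simps)
  then show "0 < Dt"
    using det_pos by simp
qed

lemma ucoord_plus_wcoord: "ucoord q + wcoord q = snd q"
proof -
  have "ucoord q + wcoord q = 1 + (ga * be + al * de) * (snd q - 1) / Dt"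
    by (simp add: ucoord_def wcoord_def algebra_simps flip: add_divide_distrib)
  also have "\<dots> = snd q"
    using coeff_pos by (simp flip: Dt_def)
  finally show ?thesis .
qed

lemma ucoord_pt [simp]: "ucoord (pt u w) = u" and wcoord_pt [simp]: "wcoord (pt u w) = w"
proof -
  have "ga * (- al * (de * (1 - u) / ga + be * w / al) + be * (u + w - 1))
      = (ga * be + al * de) * (u - 1)"
    using coeff_pos by (simp add: field_simps)
  then show "ucoord (pt u w) = u"
    using coeff_pos by (simp add: ucoord_def pt_def flip: Dt_def)
  then show "wcoord (pt u w) = w"
    using ucoord_plus_wcoord[of "pt u w"] by (simp add: pt_def)
qed

lemma pt_ucoord_wcoord [simp]: "pt (ucoord q) (wcoord q) = q"
proof -
  have "de * (1 - ucoord q) / ga + be * wcoord q / al = (ga * be + al * de) * fst q / Dt"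
    using coeff_pos by (simp add: ucoord_def wcoord_def field_simps)
  also have "\<dots> = fst q"
    using coeff_pos by (simp flip: Dt_def)
  finally show ?thesis
    by (simp add: pt_def ucoord_plus_wcoord)
qed

lemma coords_aff_id [simp]: "ucoord aff_id = 1" "wcoord aff_id = 0"
  by (simp_all add: ucoord_def wcoord_def aff_id_def)

text \<open>The point \<open>B\<close> has coordinates \<open>(0, 0)\<close>, so the sign of \<open>lambda3\<close> is that of \<open>ucoord\<close>: the regions
  \<open>D\<close> and \<open>E\<close> are told apart by whether \<open>ucoord\<close>, which starts at \<open>1\<close> and never increases along a causal curve from
  the identity, has passed \<open>0\<close>.\<close>

lemma lambda_eq:
  "lambda1 A q = Dt / ga * (ucoord q - 1)" "lambda2 A q = Dt / al * wcoord q"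
  "lambda3 A q = Dt / ga * ucoord q"
proof -
  show 1: "lambda1 A q = Dt / ga * (ucoord q - 1)" for q
    using coeff_pos by (simp add: lambda1_def ucoord_def al_def be_def)
  show "lambda2 A q = Dt / al * wcoord q"
    using coeff_pos by (simp add: lambda2_def wcoord_def ga_def de_def add.commute)
  have "ptB A = pt 0 0"
    by (simp add: ptB_def pt_def de_def ga_def add.commute)
  then show "lambda3 A q = Dt / ga * ucoord q"
    using coeff_pos by (simp add: lambda3_def 1 right_diff_distrib)
qed

lemma lor_coords_eq:
  assumes "q \<in> Aff"
  shows "lor_coords A q v $ 1 - lor_coords A q v $ 2 = - (Dt / ga * du v) / snd q"
    and "lor_coords A q v $ 1 + lor_coords A q v $ 2 = Dt / al * dw v / snd q"
proof -
  have eqs: "Dt / ga * du v = - (al * fst v - be * snd v)" "Dt / al * dw v = ga * fst v + de * snd v"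
    using coeff_pos by (simp_all add: du_def dw_def)
  show "lor_coords A q v $ 1 - lor_coords A q v $ 2 = - (Dt / ga * du v) / snd q"
    and "lor_coords A q v $ 1 + lor_coords A q v $ 2 = Dt / al * dw v / snd q"
    unfolding eqs
    by (simp_all add: lor_coords_def frame_coords_def matrix_vector_mult_def sum_2 al_def be_def
        ga_def de_def algebra_simps diff_divide_distrib add_divide_distrib)
qed

lemma future_nonspacelike_iff:
  assumes "q \<in> Aff"
  shows "future_nonspacelike A q v \<longleftrightarrow> du v \<le> 0 \<and> 0 \<le> dw v"
proof -
  have pos: "0 < snd q"
    using assms by (simp add: Aff_def)
  have "future_nonspacelike A q v \<longleftrightarrow> 0 \<le> lor_coords A q v $ 1 - lor_coords A q v $ 2 \<and>
      0 \<le> lor_coords A q v $ 1 + lor_coords A q v $ 2"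
    by (auto simp: future_nonspacelike_def)
  also have "\<dots> \<longleftrightarrow> du v \<le> 0 \<and> 0 \<le> dw v"
    unfolding lor_coords_eq[OF assms] using coeff_pos pos
    by (auto simp: zero_le_divide_iff zero_le_mult_iff mult_le_0_iff divide_le_0_iff)
  finally show ?thesis .
qed

text \<open>The Lorentzian metric is \<open>unit_length\<^sup>2 du dw / (u + w)\<^sup>2\<close>.\<close>

definition unit_length where "unit_length = Dt / sqrt (al * ga)"

lemma unit_length_pos: "0 < unit_length"
  using coeff_pos by (simp add: unit_length_def)

lemma sqrt_lor_form:
  assumes "q \<in> Aff"
  shows "sqrt (- lor_form A q v) = unit_length * (sqrt (- du v * dw v) / (ucoord q + wcoord q))"
proof -
  have pos: "0 < snd q"
    using assms by (simp add: Aff_def)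
  have "- lor_form A q v = (lor_coords A q v $ 1 - lor_coords A q v $ 2) *
      (lor_coords A q v $ 1 + lor_coords A q v $ 2)"
    by (simp add: lor_form_def algebra_simps power2_eq_square)
  also have "\<dots> = (Dt / snd q)\<^sup>2 * (- du v * dw v) / (al * ga)"
    unfolding lor_coords_eq[OF assms] by (simp add: power2_eq_square mult_ac)
  finally have "sqrt (- lor_form A q v)
      = sqrt ((Dt / snd q)\<^sup>2) * sqrt (- du v * dw v) / sqrt (al * ga)"
    by (simp only: real_sqrt_mult real_sqrt_divide)
  then show ?thesis
    using pos coeff_pos by (simp add: unit_length_def ucoord_plus_wcoord mult.commute)
qed

lemma lor_length_eq:
  assumes "nonspacelike_curve A T q"
  shows "lor_length A T q = unit_length * integral {0..T}
    (\<lambda>t. sqrt (- du (velocity T q t) * dw (velocity T q t)) / (ucoord (q t) + wcoord (q t)))"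
proof -
  have "q t \<in> Aff" if "t \<in> {0..T}" for t
    using assms that by (auto simp: nonspacelike_curve_def)
  then show ?thesis
    unfolding lor_length_def integral_mult_right[symmetric]
    by (intro integral_cong) (rule sqrt_lor_form)
qed

lemma bounded_linear_du: "bounded_linear du" and bounded_linear_dw: "bounded_linear dw"
  by (auto simp: du_def dw_def algebra_simps add_divide_distrib diff_divide_distrib
      simp flip: linear_conv_bounded_linear intro!: linearI)

lemma coord_diff: "ucoord p - ucoord q = du (p - q)" "wcoord p - wcoord q = dw (p - q)"
  by (simp_all add: ucoord_def wcoord_def du_def dw_def algebra_simps flip: diff_divide_distrib)

lemma lipschitz_coords:
  assumes "L-lipschitz_on S q"
  shows "\<exists>M. M-lipschitz_on S (\<lambda>t. ucoord (q t))" "\<exists>M. M-lipschitz_on S (\<lambda>t. wcoord (q t))"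
proof -
  obtain B1 where "0 \<le> B1" "\<And>v. norm (du v) \<le> norm v * B1"
    using bounded_linear.nonneg_bounded[OF bounded_linear_du] by blast
  then have "B1-lipschitz_on UNIV ucoord"
    by (intro lipschitz_onI) (simp_all add: dist_norm coord_diff mult.commute flip: real_norm_def)
  then show "\<exists>M. M-lipschitz_on S (\<lambda>t. ucoord (q t))"
    using lipschitz_on_compose2[OF assms lipschitz_on_subset] by blast
  obtain B2 where "0 \<le> B2" "\<And>v. norm (dw v) \<le> norm v * B2"
    using bounded_linear.nonneg_bounded[OF bounded_linear_dw] by blast
  then have "B2-lipschitz_on UNIV wcoord"
    by (intro lipschitz_onI) (simp_all add: dist_norm coord_diff mult.commute flip: real_norm_def)
  then show "\<exists>M. M-lipschitz_on S (\<lambda>t. wcoord (q t))"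
    using lipschitz_on_compose2[OF assms lipschitz_on_subset] by blast
qed

lemma coords_has_vector_derivative:
  assumes "(q has_vector_derivative v) (at t within S)"
  shows "((\<lambda>t. ucoord (q t)) has_vector_derivative du v) (at t within S)"
    and "((\<lambda>t. wcoord (q t)) has_vector_derivative dw v) (at t within S)"
proof -
  have "((\<lambda>t. ucoord 0 + du (q t)) has_vector_derivative 0 + du v) (at t within S)"
    by (intro has_vector_derivative_add has_vector_derivative_const
        bounded_linear.has_vector_derivative[OF bounded_linear_du] assms)
  moreover have "ucoord 0 + du (q t) = ucoord (q t)" for t
    using coord_diff(1)[of "q t" 0] by simp
  ultimately show "((\<lambda>t. ucoord (q t)) has_vector_derivative du v) (at t within S)"
    by simp
  have "((\<lambda>t. wcoord 0 + dw (q t)) has_vector_derivative 0 + dw v) (at t within S)"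
    by (intro has_vector_derivative_add has_vector_derivative_const
        bounded_linear.has_vector_derivative[OF bounded_linear_dw] assms)
  moreover have "wcoord 0 + dw (q t) = wcoord (q t)" for t
    using coord_diff(2)[of "q t" 0] by simp
  ultimately show "((\<lambda>t. wcoord (q t)) has_vector_derivative dw v) (at t within S)"
    by simp
qed

section \<open>The distance bound in region D\<close>

lemma lor_length_le:
  assumes curve: "nonspacelike_curve_from_to A aff_id q1 T q" and q1: "0 < ucoord q1"
  shows "lor_length A T q
    \<le> unit_length * arctan (sqrt ((1 / ucoord q1 - 1) * (wcoord q1 / (1 + wcoord q1))))"
proof -
  let ?v = "velocity T q"
  have c: "nonspacelike_curve A T q" and ends: "q 0 = aff_id" "q T = q1"
    using curve by (auto simp: nonspacelike_curve_from_to_def)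
  have T: "0 < T" and Aff: "\<And>t. t \<in> {0..T} \<Longrightarrow> q t \<in> Aff"
    using c by (auto simp: nonspacelike_curve_def)
  obtain L where "L-lipschitz_on {0..T} q"
    using c by (auto simp: nonspacelike_curve_def)
  from lipschitz_coords[OF this] obtain L1 L2 where
    lip: "L1-lipschitz_on {0..T} (\<lambda>t. ucoord (q t))" "L2-lipschitz_on {0..T} (\<lambda>t. wcoord (q t))"
    by blast
  have "AE t\<in>{0..T} in lebesgue. q differentiable (at t within {0..T}) \<and>
      future_nonspacelike A (q t) (?v t)"
    using c by (simp add: nonspacelike_curve_def)
  then obtain N where N: "N \<in> null_sets lebesgue" and
    good: "{t \<in> space lebesgue. \<not> (t \<in> {0..T} \<longrightarrow> q differentiable (at t within {0..T}) \<and>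
      future_nonspacelike A (q t) (?v t))} \<subseteq> N"
    unfolding eventually_ae_filter by blast
  have "((\<lambda>t. ucoord (q t)) has_vector_derivative du (?v t)) (at t within {0..T}) \<and>
      ((\<lambda>t. wcoord (q t)) has_vector_derivative dw (?v t)) (at t within {0..T}) \<and>
      du (?v t) \<le> 0 \<and> 0 \<le> dw (?v t)" if t: "t \<in> {0..T} - N" for t
  proof -
    have "q differentiable (at t within {0..T})" "future_nonspacelike A (q t) (?v t)"
      using good t by auto
    then show ?thesis
      using coords_has_vector_derivative[of q "?v t" t "{0..T}"] future_nonspacelike_iff[OF Aff] t
      by (auto simp: velocity_def vector_derivative_works)
  qed
  from null_length_bound[OF _ lip _ this] N T q1 show ?thesis
    unfolding lor_length_eq[OF c]
    using unit_length_pos by (intro mult_left_mono) (simp_all add: ends negligible_iff_null_sets)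
qed

section \<open>Curves prescribed by null coordinates\<close>

lemma pt_diff: "pt u w - pt u0 w0 = (u - u0) *\<^sub>R (- de / ga, 1) + (w - w0) *\<^sub>R (be / al, 1)"
  by (simp add: pt_def diff_divide_distrib algebra_simps)

lemma curve_of_null_coords:
  fixes u w u' w' :: "real \<Rightarrow> real"
  assumes T: "0 < T" and lip: "L-lipschitz_on {0..T} u" "M-lipschitz_on {0..T} w"
    and pos: "\<And>t. t \<in> {0..T} \<Longrightarrow> 0 < u t + w t"
    and N: "negligible N"
    and deriv: "\<And>t. t \<in> {0..T} - N \<Longrightarrow> (u has_vector_derivative u' t) (at t within {0..T}) \<and>
      (w has_vector_derivative w' t) (at t within {0..T}) \<and> u' t \<le> 0 \<and> 0 \<le> w' t"
  shows "nonspacelike_curve A T (\<lambda>t. pt (u t) (w t))"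
    and "lor_length A T (\<lambda>t. pt (u t) (w t))
      = unit_length * integral {0..T} (\<lambda>t. sqrt (- u' t * w' t) / (u t + w t))"
proof -
  let ?q = "\<lambda>t. pt (u t) (w t)"
  define v where "v t = pt (u' t) (w' t) - pt 0 0" for t
  have dv: "du (v t) = u' t" "dw (v t) = w' t" for t
    unfolding v_def by (simp_all flip: coord_diff)
  have Aff: "?q t \<in> Aff" if "t \<in> {0..T}" for t
    using pos[OF that] by (simp add: Aff_def pt_def)
  have q_deriv: "(?q has_vector_derivative v t) (at t within {0..T})" if t: "t \<in> {0..T} - N" for t
  proof -
    have "((\<lambda>t. pt 0 0 + (u t *\<^sub>R (- de / ga, 1) + w t *\<^sub>R (be / al, 1))) has_vector_derivative
        0 + (u' t *\<^sub>R (- de / ga, 1) + w' t *\<^sub>R (be / al, 1))) (at t within {0..T})"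
      using deriv[OF t]
      by (intro has_vector_derivative_add has_vector_derivative_const
          bounded_linear.has_vector_derivative[OF bounded_linear_scaleR_left]) auto
    moreover have "pt 0 0 + (u t *\<^sub>R (- de / ga, 1) + w t *\<^sub>R (be / al, 1)) = ?q t" for t
      using pt_diff[of "u t" "w t" 0 0] by (simp add: algebra_simps)
    ultimately show ?thesis
      by (simp add: v_def pt_diff)
  qed
  then have velocity_eq: "velocity T ?q t = v t" if "t \<in> {0..T} - N" for t
    using T that unfolding velocity_def by (intro vector_derivative_within_closed_interval) auto
  have good: "?q differentiable (at t within {0..T}) \<and>
      future_nonspacelike A (?q t) (velocity T ?q t)" if t: "t \<in> {0..T} - N" for t
    using deriv[OF t] t differentiableI_vector[OF q_deriv[OF t]]
    by (simp add: future_nonspacelike_iff[OF Aff] velocity_eq dv)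
  have "(L * norm (- de / ga, 1::real) + M * norm (be / al, 1::real))-lipschitz_on {0..T} ?q"
  proof (rule lipschitz_onI)
    fix s t assume st: "s \<in> {0..T}" "t \<in> {0..T}"
    have "dist (?q s) (?q t) \<le> \<bar>u s - u t\<bar> * norm (- de / ga, 1::real) + \<bar>w s - w t\<bar> * norm (be / al, 1::real)"
      unfolding dist_norm pt_diff by (metis norm_scaleR norm_triangle_ineq)
    also have "\<dots> \<le> (L * dist s t) * norm (- de / ga, 1::real) + (M * dist s t) * norm (be / al, 1::real)"
      using lipschitz_onD[OF lip(1) st] lipschitz_onD[OF lip(2) st]
      by (intro add_mono mult_right_mono) (auto simp: dist_real_def)
    finally show "dist (?q s) (?q t)
        \<le> (L * norm (- de / ga, 1::real) + M * norm (be / al, 1::real)) * dist s t"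
      by (simp add: algebra_simps)
  qed (use lip[THEN lipschitz_on_nonneg] in auto)
  moreover have "AE t\<in>{0..T} in lebesgue. ?q differentiable (at t within {0..T}) \<and>
      future_nonspacelike A (?q t) (velocity T ?q t)"
  proof (rule AE_I')
    show "N \<in> null_sets lebesgue"
      using N by (simp add: negligible_iff_null_sets)
    show "{t \<in> space lebesgue. \<not> (t \<in> {0..T} \<longrightarrow> ?q differentiable (at t within {0..T}) \<and>
      future_nonspacelike A (?q t) (velocity T ?q t))} \<subseteq> N"
      using good by auto
  qed
  ultimately show curve: "nonspacelike_curve A T ?q"
    using T Aff by (auto simp: nonspacelike_curve_def)
  show "lor_length A T ?q = unit_length * integral {0..T} (\<lambda>t. sqrt (- u' t * w' t) / (u t + w t))"
    unfolding lor_length_eq[OF curve]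
    by (intro arg_cong[of _ _ "(*) unit_length"] integral_spike[OF N]) (simp add: velocity_eq dv)
qed

section \<open>The maximizer in region D\<close>

text \<open>Equality in the arithmetic-geometric inequality of the calibration holds along the rays
  \<open>(g s, h s)\<close> from the origin of the coordinates \<open>g = 1 / u - 1\<close>, \<open>h = w / (1 + w)\<close>. These are the
  timelike geodesics, with null or constant segments in the limiting cases \<open>g = 0\<close> or \<open>h = 0\<close>.
  Moving back to \<open>u\<close> and \<open>w\<close> gives the formulas below.\<close>

lemma maximizing_geodesic:
  assumes q1: "0 < ucoord q1" "ucoord q1 \<le> 1" "0 \<le> wcoord q1"
  shows "\<exists>q. nonspacelike_curve_from_to A aff_id q1 1 q \<and> lor_length A 1 q
    = unit_length * arctan (sqrt ((1 / ucoord q1 - 1) * (wcoord q1 / (1 + wcoord q1))))"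
proof -
  define g where "g = 1 / ucoord q1 - 1"
  define h where "h = wcoord q1 / (1 + wcoord q1)"
  have g: "0 \<le> g" and h: "0 \<le> h" "h < 1"
    using q1 by (auto simp: g_def h_def)
  define u u' where "u s = 1 / (1 + g * s)" and "u' s = - g / (1 + g * s)\<^sup>2" for s
  define w w' where "w s = h * s / (1 - h * s)" and "w' s = h / (1 - h * s)\<^sup>2" for s
  have pos: "1 \<le> 1 + g * s" "1 - h \<le> 1 - h * s" "0 < 1 - h * s" if "s \<in> {0..1}" for s
  proof -
    show "1 \<le> 1 + g * s" "1 - h \<le> 1 - h * s"
      using that g h by (auto simp: mult_left_le)
    then show "0 < 1 - h * s"
      using h by simp
  qed
  have deriv_u: "(u has_real_derivative u' s) (at s within {0..1})" if "s \<in> {0..1}" for s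
    unfolding u_def[abs_def] u'_def using pos(1)[OF that]
    by (auto intro!: derivative_eq_intros simp: power2_eq_square)
  have deriv_w: "(w has_real_derivative w' s) (at s within {0..1})" if "s \<in> {0..1}" for s
    unfolding w_def[abs_def] w'_def using pos(3)[OF that]
    by (auto intro!: derivative_eq_intros simp: power2_eq_square divide_simps) (simp add: algebra_simps)
  have lip_u: "g-lipschitz_on {0..1} u"
  proof (rule lipschitz_on_if_bounded_real_derivative[OF _ g deriv_u])
    show "\<bar>u' s\<bar> \<le> g" if "s \<in> {0..1}" for s
      using g pos(1)[OF that] by (simp add: u'_def divide_le_eq mult_left_le_one_le mult_le_cancel_left1)
  qed auto
  have lip_w: "(h / (1 - h)\<^sup>2)-lipschitz_on {0..1} w"
  proof (rule lipschitz_on_if_bounded_real_derivative[OF _ _ deriv_w])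
    show "\<bar>w' s\<bar> \<le> h / (1 - h)\<^sup>2" if "s \<in> {0..1}" for s
      using h pos(2,3)[OF that] by (auto simp: w'_def intro!: frac_le power_mono)
  qed (use h in auto)
  have sum_pos: "0 < u s + w s" if "s \<in> {0..1}" for s
    using pos[OF that] h that by (auto simp: u_def w_def intro!: add_pos_nonneg)
  have deriv: "(u has_vector_derivative u' s) (at s within {0..1}) \<and>
      (w has_vector_derivative w' s) (at s within {0..1}) \<and> u' s \<le> 0 \<and> 0 \<le> w' s"
    if "s \<in> {0..1} - {}" for s
    using deriv_u deriv_w that g h
    by (auto simp: u'_def w'_def has_real_derivative_iff_has_vector_derivative divide_nonpos_nonneg)
  note curve = curve_of_null_coords[OF zero_less_one lip_u lip_w sum_pos negligible_empty deriv]
  have integrand: "sqrt (- u' s * w' s) / (u s + w s) = sqrt (g * h) / (1 + (sqrt (g * h) * s)\<^sup>2)"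
    if s: "s \<in> {0..1}" for s
  proof -
    note p = pos[OF s]
    have "- u' s * w' s = (g * h) / ((1 + g * s) * (1 - h * s))\<^sup>2"
      by (simp add: u'_def w'_def power_mult_distrib)
    then have 1: "sqrt (- u' s * w' s) = sqrt (g * h) / ((1 + g * s) * (1 - h * s))"
      using p by (simp add: real_sqrt_divide)
    have 2: "u s + w s = (1 + (sqrt (g * h) * s)\<^sup>2) / ((1 + g * s) * (1 - h * s))"
      using p g h by (simp add: u_def w_def power_mult_distrib divide_simps)
        (simp add: algebra_simps power2_eq_square)
    show ?thesis
      unfolding 1 2 using p by simp
  qed
  have "((\<lambda>s. sqrt (g * h) / (1 + (sqrt (g * h) * s)\<^sup>2)) has_integral
      (arctan (sqrt (g * h) * 1) - arctan (sqrt (g * h) * 0))) {0..1}"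
    by (intro fundamental_theorem_of_calculus)
      (auto intro!: derivative_eq_intros simp: divide_inverse
        simp flip: has_real_derivative_iff_has_vector_derivative)
  then have "((\<lambda>s. sqrt (- u' s * w' s) / (u s + w s)) has_integral arctan (sqrt (g * h))) {0..1}"
    using integrand by (subst has_integral_cong) auto
  then have "lor_length A 1 (\<lambda>s. pt (u s) (w s)) = unit_length * arctan (sqrt (g * h))"
    using curve(2) by (simp add: integral_unique)
  moreover have "nonspacelike_curve_from_to A aff_id q1 1 (\<lambda>s. pt (u s) (w s))"
  proof -
    have "pt (u 0) (w 0) = pt (ucoord aff_id) (wcoord aff_id)"
      by (simp add: u_def w_def)
    moreover have "u 1 = ucoord q1"
      by (simp add: u_def g_def)
    moreover have "w 1 = wcoord q1"
      using q1 by (simp add: w_def h_def field_simps)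
    ultimately show ?thesis
      using curve(1) by (simp add: nonspacelike_curve_from_to_def del: coords_aff_id)
  qed
  ultimately show ?thesis
    unfolding g_def h_def by blast
qed

section \<open>Long curves in region E\<close>

text \<open>With \<open>w - u\<close> as time, a curve is causal iff \<open>y = u + w\<close> is a 1-Lipschitz function of time. The
  smallest 1-Lipschitz function that joins the endpoints and stays at or above \<open>e > 0\<close> descends along
  a null line to the height \<open>e\<close>, stays there and ascends along a null line. As the target has
  \<open>u < 0\<close>, the horizontal piece lasts for a time more than \<open>- 2 u\<close> whatever \<open>e\<close> is, and the metric
  blows up like \<open>1 / y\<^sup>2\<close>; so the length is of order \<open>1 / e\<close>.\<close>

lemma arbitrarily_long_curve:
  assumes q1: "q1 \<in> Aff" "ucoord q1 < 0"
  shows "\<exists>T q. nonspacelike_curve_from_to A aff_id q1 T q \<and> R < lor_length A T q"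
proof -
  define a b where "a = ucoord q1" and "b = wcoord q1"
  have a: "a < 0" and ab: "0 < a + b"
    using q1 by (auto simp: a_def b_def ucoord_plus_wcoord Aff_def)
  define e where "e = min (min (1 / 2) (a + b)) (unit_length * (- a) / (\<bar>R\<bar> + 1))"
  have e: "0 < e" "e < 1" "e \<le> a + b" "e \<le> unit_length * (- a) / (\<bar>R\<bar> + 1)"
    using a ab unit_length_pos
    by (auto simp: e_def divide_less_0_iff mult_less_0_iff add_nonneg_pos)
  define T where "T = b - a + 1"
  have T: "0 < T"
    using a ab by (simp add: T_def)
  \<comment> \<open>Time starts at \<open>w - u = - 1\<close>, so the time parameter is \<open>t = w - u + 1\<close>.\<close>
  define y where "y t = max e (max (1 - t) (t + 2 * a - 1))" for t
  define y' :: "real \<Rightarrow> real" where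
    "y' t = (if t < 1 - e then - 1 else if t \<le> 1 - 2 * a + e then 0 else 1)" for t
  define u w where "u t = (y t - (t - 1)) / 2" and "w t = (y t + (t - 1)) / 2" for t
  define u' w' where "u' t = (y' t - 1) / 2" and "w' t = (y' t + 1) / 2" for t
  have lip: "1-lipschitz_on {0..T} u" "1-lipschitz_on {0..T} w"
    by (auto intro!: lipschitz_onI simp: u_def w_def y_def dist_real_def max_def abs_if field_simps)
  have deriv_y: "(y has_real_derivative y' t) (at t)" if "t \<notin> {1 - e, 1 - 2 * a + e}" for t
  proof -
    have "t \<noteq> 1 - e" "t \<noteq> 1 - 2 * a + e"
      using that by auto
    then have "t < 1 - e \<or> (1 - e < t \<and> t < 1 - 2 * a + e) \<or> 1 - 2 * a + e < t"
      by linarith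
    then consider "t < 1 - e" | "1 - e < t" "t < 1 - 2 * a + e" | "1 - 2 * a + e < t"
      by blast
    then show ?thesis
    proof cases
      case 1
      have "((\<lambda>t. 1 - t) has_real_derivative - 1) (at t)"
        by (auto intro!: derivative_eq_intros)
      then have "(y has_real_derivative - 1) (at t)"
        by (rule has_field_derivative_transform_within_open[where S = "{..<1 - e}"])
          (use 1 a e in \<open>auto simp: y_def\<close>)
      then show ?thesis
        using 1 by (simp add: y'_def)
    next
      case 2
      have "((\<lambda>t. e) has_real_derivative 0) (at t)"
        by (rule DERIV_const)
      then have "(y has_real_derivative 0) (at t)"
        by (rule has_field_derivative_transform_within_open[where S = "{1 - e<..<1 - 2 * a + e}"])
          (use 2 a e in \<open>auto simp: y_def\<close>)
      then show ?thesis
        using 2 by (simp add: y'_def)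
    next
      case 3
      have "((\<lambda>t. t + 2 * a - 1) has_real_derivative 1) (at t)"
        by (auto intro!: derivative_eq_intros)
      then have "(y has_real_derivative 1) (at t)"
        by (rule has_field_derivative_transform_within_open[where S = "{1 - 2 * a + e<..}"])
          (use 3 a e in \<open>auto simp: y_def\<close>)
      then show ?thesis
        using 3 a e by (simp add: y'_def)
    qed
  qed
  have deriv: "(u has_vector_derivative u' t) (at t within {0..T}) \<and>
      (w has_vector_derivative w' t) (at t within {0..T}) \<and> u' t \<le> 0 \<and> 0 \<le> w' t"
    if t: "t \<in> {0..T} - {1 - e, 1 - 2 * a + e}" for t
  proof -
    have y: "(y has_real_derivative y' t) (at t within {0..T})"
      using deriv_y t by (auto intro: has_field_derivative_at_within)
    have "(u has_real_derivative u' t) (at t within {0..T})"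
      "(w has_real_derivative w' t) (at t within {0..T})"
      unfolding u_def[abs_def] w_def[abs_def] u'_def w'_def
      by (auto intro!: derivative_eq_intros y)
    then show ?thesis
      by (auto simp: has_real_derivative_iff_has_vector_derivative u'_def w'_def y'_def)
  qed
  have sum_eq: "u t + w t = y t" for t
    by (simp add: u_def w_def field_simps)
  have sum_pos: "0 < u t + w t" if "t \<in> {0..T}" for t
    using e by (simp add: sum_eq y_def)
  have "negligible {1 - e, 1 - 2 * a + e}"
    by (simp add: negligible_finite)
  note curve = curve_of_null_coords[OF T lip sum_pos this deriv]
  have integrand: "sqrt (- u' t * w' t) / (u t + w t)
      = (if t \<in> {1 - e..1 - 2 * a + e} then 1 / (2 * e) else 0)" for t
  proof -
    have "- u' t * w' t = (if t \<in> {1 - e..1 - 2 * a + e} then (1 / 2)\<^sup>2 else 0)"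
      using a e by (auto simp: u'_def w'_def y'_def power2_eq_square)
    moreover have "y t = e" if "t \<in> {1 - e..1 - 2 * a + e}"
      using that by (auto simp: y_def)
    ultimately show ?thesis
      by (auto simp: sum_eq)
  qed
  have "((\<lambda>t. 1 / (2 * e)) has_integral (1 / (2 * e)) * ((1 - 2 * a + e) - (1 - e))) {1 - e..1 - 2 * a + e}"
    using has_integral_const_real[of "1 / (2 * e)" "1 - e" "1 - 2 * a + e"] a e
    by (simp add: mult.commute)
  also have "(1 / (2 * e)) * ((1 - 2 * a + e) - (1 - e)) = 1 + (- a) / e"
    using e by (simp add: field_simps)
  finally have "((\<lambda>t. sqrt (- u' t * w' t) / (u t + w t)) has_integral (1 + (- a) / e)) {0..T}"
    unfolding integrand
    by (subst has_integral_restrict) (use a e in \<open>auto simp: T_def\<close>)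
  then have "lor_length A T (\<lambda>t. pt (u t) (w t)) = unit_length * (1 + (- a) / e)"
    using curve(2) by (simp add: integral_unique)
  also have "\<dots> > R"
  proof -
    have "e * (\<bar>R\<bar> + 1) \<le> unit_length * (- a)"
      using e(4) by (subst (asm) pos_le_divide_eq) auto
    then have "\<bar>R\<bar> + 1 \<le> unit_length * (- a) / e"
      using e(1) by (subst pos_le_divide_eq) (auto simp: mult.commute)
    moreover have "unit_length * (1 + (- a) / e) = unit_length + unit_length * (- a) / e"
      by (simp only: distrib_left mult_1_right times_divide_eq_right)
    ultimately show ?thesis
      using unit_length_pos by linarith
  qed
  finally have "R < lor_length A T (\<lambda>t. pt (u t) (w t))" .
  moreover have "nonspacelike_curve_from_to A aff_id q1 T (\<lambda>t. pt (u t) (w t))"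
  proof -
    have "y 0 = 1" "y T = a + b"
      using a ab e by (auto simp: y_def T_def)
    then have "u 0 = ucoord aff_id" "w 0 = wcoord aff_id" "u T = ucoord q1" "w T = wcoord q1"
      by (auto simp: u_def w_def T_def a_def b_def)
    then show ?thesis
      using curve(1) by (simp add: nonspacelike_curve_from_to_def del: coords_aff_id)
  qed
  ultimately show ?thesis
    by blast
qed

end

section \<open>Existence and nonexistence of maximizers\<close>

theorem theorem9:
  fixes A :: "real ^ 2 ^ 2" and q1 :: "real \<times> real"
  assumes det_pos: "det A > 0"
    and a_nonneg: "A $ 1 $ 1 \<ge> 0"
    and K_neg: "sectional_curvature A < 0"
    and q1_future: "q1 \<in> causal_future A aff_id"
  shows "(q1 \<in> regionD A \<longrightarrow> (\<exists>t1 q. length_maximizer A aff_id q1 t1 q)) \<and>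
         (q1 \<in> regionE A \<longrightarrow>
            (\<forall>M::real. \<exists>t1 q. nonspacelike_curve_from_to A aff_id q1 t1 q \<and> lor_length A t1 q > M) \<and>
            lor_dist A aff_id q1 = \<infinity> \<and>
            \<not> (\<exists>t1 q. length_maximizer A aff_id q1 t1 q))"
proof -
  have "(A $ 2 $ 1)\<^sup>2 < (A $ 1 $ 1)\<^sup>2"
    using K_neg by (simp add: sectional_curvature_def divide_less_0_iff)
  then have "\<bar>A $ 2 $ 1\<bar> < A $ 1 $ 1"
    using a_nonneg by (metis abs_le_square_iff abs_of_nonneg not_le)
  then interpret negatively_curved_aff A
    using det_pos by unfold_locales
  have "\<exists>t1 q. length_maximizer A aff_id q1 t1 q" if D: "q1 \<in> regionD A"
  proof -
    have q1: "0 < ucoord q1" "ucoord q1 \<le> 1" "0 \<le> wcoord q1"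
      using D coeff_pos by (auto simp: regionD_def lambda_eq zero_less_mult_iff zero_le_mult_iff
          mult_le_0_iff zero_less_divide_iff zero_le_divide_iff divide_le_0_iff)
    obtain q where q: "nonspacelike_curve_from_to A aff_id q1 1 q"
      "lor_length A 1 q = unit_length * arctan (sqrt ((1 / ucoord q1 - 1) * (wcoord q1 / (1 + wcoord q1))))"
      using maximizing_geodesic[OF q1] by blast
    have "lor_dist A aff_id q1 = ereal (lor_length A 1 q)"
      unfolding lor_dist_def
    proof (rule antisym)
      show "Sup {ereal (lor_length A t1 q) |t1 q. nonspacelike_curve_from_to A aff_id q1 t1 q}
          \<le> ereal (lor_length A 1 q)"
        using lor_length_le[OF _ q1(1)] by (auto intro!: Sup_least simp: q(2))
      show "ereal (lor_length A 1 q)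
          \<le> Sup {ereal (lor_length A t1 q) |t1 q. nonspacelike_curve_from_to A aff_id q1 t1 q}"
        using q(1) by (intro Sup_upper) blast
    qed
    then show ?thesis
      using q(1) by (auto simp: length_maximizer_def)
  qed
  moreover have "(\<forall>M::real. \<exists>t1 q. nonspacelike_curve_from_to A aff_id q1 t1 q \<and> lor_length A t1 q > M) \<and>
      lor_dist A aff_id q1 = \<infinity> \<and> \<not> (\<exists>t1 q. length_maximizer A aff_id q1 t1 q)"
    if E: "q1 \<in> regionE A"
  proof -
    have "q1 \<in> Aff" "ucoord q1 < 0"
      using E coeff_pos by (auto simp: regionE_def lambda_eq mult_less_0_iff divide_less_0_iff)
    then have long: "\<exists>t1 q. nonspacelike_curve_from_to A aff_id q1 t1 q \<and> lor_length A t1 q > M" for M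
      by (rule arbitrarily_long_curve)
    have "lor_dist A aff_id q1 = \<infinity>"
    proof (rule ereal_top)
      fix M
      obtain t1 q where "nonspacelike_curve_from_to A aff_id q1 t1 q" "lor_length A t1 q > M"
        using long by blast
      then show "ereal M \<le> lor_dist A aff_id q1"
        unfolding lor_dist_def by (intro Sup_upper2[of "ereal (lor_length A t1 q)"]) auto
    qed
    then show ?thesis
      using long by (auto simp: length_maximizer_def)
  qed
  ultimately show ?thesis
    by blast
qed

end
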